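(* Consider weighted Lagrange interpolation on $\mathbb{R}$ with the Hermite weight $e^{-t^2}$ at $n=3$ nodes $x_1<x_2<x_3$. Let $C$ be the largest real root of the equation $e^{-u}(4u-1)=1$, let $c=\sqrt{C}$, and let $\mathbf{x}^*=(-c,0,c)$. Then $P_1(\mathbf{x}^*,t)=P_4(\mathbf{x}^*,t)=e^{-t^2}(4t^2-1)$; the maximum of $L(\mathbf{x}^*,\cdot)$ on $I_1=(-\infty,-c]$ is $1$, attained only at $-c$, and its maximum on $I_4=[c,\infty)$ is $1$, attained only at $c$; moreover $P_1'(\mathbf{x}^*,-c)>0$ and $P_4'(\mathbf{x}^*,c)<0$. It follows that $\nabla m_1(\mathbf{x}^* )=\nabla m_4(\mathbf{x}^* )=\mathbf{0}$. In particular, for the derivative matrix $A=[\partial m_i/\partial x_j]_{i=1,\dots,4;\,j=1,2,3}$ at $\mathbf{x}^*$, none of the matrices $A_k$ ($k=1,\dots,4$) obtained by deleting the $k$th row of $A$ is nonsingular.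
   Context: For nodes $\mathbf{x}=(x_1,x_2,x_3)$ with $x_1<x_2<x_3$ put $I_1=(-\infty,x_1]$, $I_2=[x_1,x_2]$, $I_3=[x_2,x_3]$, $I_4=[x_3,\infty)$. The fundamental functions are $$h_k(\mathbf{x},t)=\frac{e^{-t^2}}{e^{-x_k^2}}\prod_{l=1,\,l\ne k}^3\frac{t-x_l}{x_k-x_l},\quad k=1,2,3.$$ The Lebesgue function is $L(\mathbf{x},t)=\sum_{k=1}^3|h_k(\mathbf{x},t)|$, and $m_i(\mathbf{x})=\max_{t\in I_i}L(\mathbf{x},t)$ for $i=1,\dots,4$. $P_i(\mathbf{x},\cdot)$ is the function of the form $e^{-t^2}p(t)$, $p$ a real polynomial of degree at most $2$, which agrees with $L(\mathbf{x},\cdot)$ on $I_i$; $P_i'$ is its derivative with respect to $t$, and $\nabla m_i$ is the gradient with respect to $(x_1,x_2,x_3)$. *)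

theory Defs
  imports "HOL-Analysis.Analysis" "HOL-Computational_Algebra.Polynomial"
begin

text \<open>
  The types \<^typ>\<open>3\<close> and \<^typ>\<open>4\<close> serve only as index sets, with elements 1, 2, 3 and
  1, 2, 3, 4 respectively.  Note that \<^prop>\<open>(3::3) = 0\<close> and \<^prop>\<open>(4::4) = 0\<close>, so their
  built-in order is not the order of the labels; it is never used.
\<close>

definition fund_fun :: "real^3 \<Rightarrow> 3 \<Rightarrow> real \<Rightarrow> real" where
  "fund_fun x k t =
     exp (- t\<^sup>2) / exp (- (x $ k)\<^sup>2) * (\<Prod>l\<in>UNIV - {k}. (t - x $ l) / (x $ k - x $ l))"

definition lebesgue_fun :: "real^3 \<Rightarrow> real \<Rightarrow> real" where
  "lebesgue_fun x t = (\<Sum>k\<in>UNIV. \<bar>fund_fun x k t\<bar>)"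

definition node_interval :: "4 \<Rightarrow> real^3 \<Rightarrow> real set" where
  "node_interval i x =
     (if i = 1 then {..x $ 1}
      else if i = 2 then {x $ 1..x $ 2}
      else if i = 3 then {x $ 2..x $ 3}
      else {x $ 3..})"

definition interval_max :: "4 \<Rightarrow> real^3 \<Rightarrow> real" where
  "interval_max i x = (GREATEST y. y \<in> lebesgue_fun x ` node_interval i x)"

definition interval_fun :: "4 \<Rightarrow> real^3 \<Rightarrow> real \<Rightarrow> real" where
  "interval_fun i x =
     (THE f. \<exists>p :: real poly. degree p \<le> 2 \<and> f = (\<lambda>t. exp (- t\<^sup>2) * poly p t) \<and>
        (\<forall>t\<in>node_interval i x. f t = lebesgue_fun x t))"

definition deriv_matrix :: "real^3 \<Rightarrow> real^3^4" where
  "deriv_matrix x = (\<chi> i j. deriv (\<lambda>s. interval_max i (x + s *\<^sub>R axis j 1)) 0)"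

definition delete_row :: "4 \<Rightarrow> real^3^4 \<Rightarrow> real^3^3" where
  "delete_row k A = vector [A $ i. i \<leftarrow> [1, 2, 3, 4], i \<noteq> k]"

end

theory Submission
  imports Defs
begin

text \<open>
  On each interval between or beyond the nodes the fundamental functions have constant signs, so
  the Lebesgue function is there \<open>exp (- t\<^sup>2)\<close> times a quadratic polynomial \<open>signed_poly\<close>, whose
  coefficients are differentiable functions of the nodes.

  For the nodes \<open>- c, 0, c\<close> the polynomial on the last interval is
  \<open>((exp C + 1) / C) * t\<^sup>2 - 1\<close>, and the equation for \<open>C\<close> makes it \<open>4 * t\<^sup>2 - 1\<close>
  (\<open>signed_poly_outer_xs\<close>).  The derivative of \<open>exp (- t\<^sup>2) * (4 * t\<^sup>2 - 1)\<close> has the sign of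
  \<open>t * (5 - 4 * t\<^sup>2)\<close>, and since \<open>exp (5/4) < 4\<close> the largest root satisfies \<open>C > 5/4\<close>
  (\<open>greatest_root_gt\<close>).  So the Lebesgue function decreases strictly beyond \<open>c\<close>, from the value 1
  that it takes at every node.  This decrease is stable: it persists on the whole half-line beyond the
  last node for all nodes near the critical ones (\<open>gauss_quadratic_decreasing\<close>, \<open>outer_strict\<close>).
  Hence the fourth maximum is identically 1 near the critical nodes and its gradient is zero.
  Reflection at the origin, which fixes the critical nodes, transfers this to the first interval.
  The derivative matrix therefore has two zero rows, one of which survives the deletion of any row.

  It remains to see that the partial derivatives of the two inner maxima exist, so that the matrix
  is a genuine derivative matrix.  On \<open>{0..c}\<close> the Lebesgue function has a unique maximiser, in the
  interior (\<open>inner_max\<close>).  By uniqueness and compactness the maximisers for nearby nodes are close to it, and the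
  envelope theorem \<open>envelope_has_derivative\<close> makes the third maximum differentiable at the critical
  nodes; reflection gives the second one.
\<close>

section \<open>The envelope theorem for separated families\<close>

lemma has_derivative_real_iff_quotient:
  fixes f :: "'a::real_normed_vector \<Rightarrow> real"
  shows "(f has_derivative f') (at y) \<longleftrightarrow>
    bounded_linear f' \<and> ((\<lambda>x. (f x - f y - f' (x - y)) / norm (x - y)) \<longlongrightarrow> 0) (at y)"
  unfolding has_derivative_iff_norm
  by (subst (2) tendsto_norm_zero_iff[symmetric]) (simp add: abs_divide)

text \<open>The increment of \<open>u\<close> is of order \<open>norm (x - y)\<close>, so a factor that merely tends to zero
  already makes the product negligible.  Below, \<open>v\<close> is built from a maximiser of which only convergence is known.\<close>

lemma has_derivative_mult_tendsto_zero:
  fixes u v :: "'a::real_normed_vector \<Rightarrow> real"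
  assumes u: "(u has_derivative u') (at y)" and v: "(v \<longlongrightarrow> 0) (at y)" and v0: "v y = 0"
  shows "((\<lambda>x. (u x - u y) * v x) has_derivative (\<lambda>h. 0)) (at y)"
proof -
  have bl: "bounded_linear u'" using u by (rule has_derivative_bounded_linear)
  obtain B where B: "\<And>h. norm (u' h) \<le> norm h * B"
    using bounded_linear.bounded[OF bl] by metis
  have "((\<lambda>x. (u x - u y - u' (x - y)) / norm (x - y)) \<longlongrightarrow> 0) (at y)"
    using u unfolding has_derivative_real_iff_quotient by simp
  from tendsto_mult[OF this v]
  have 1: "((\<lambda>x. (u x - u y - u' (x - y)) / norm (x - y) * v x) \<longlongrightarrow> 0) (at y)" by simp
  have 2: "((\<lambda>x. u' (x - y) / norm (x - y) * v x) \<longlongrightarrow> 0) (at y)"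
  proof (rule tendsto_0_le[OF v, where K = "B"])
    show "\<forall>\<^sub>F x in at y. norm (u' (x - y) / norm (x - y) * v x) \<le> norm (v x) * B"
    proof (rule eventually_at_topological[THEN iffD2], intro exI[of _ UNIV] conjI ballI impI)
      fix x assume "x \<noteq> y"
      then have "norm (u' (x - y)) / norm (x - y) \<le> B"
        using B[of "x - y"] by (simp add: divide_le_eq mult.commute)
      from mult_left_mono[OF this, of "norm (v x)"]
      show "norm (u' (x - y) / norm (x - y) * v x) \<le> norm (v x) * B"
        by (simp add: abs_mult mult.commute)
    qed auto
  qed
  have "((\<lambda>x. ((u x - u y) * v x) / norm (x - y)) \<longlongrightarrow> 0) (at y)"
    using tendsto_add[OF 1 2] by (simp add: algebra_simps diff_divide_distrib add_divide_distrib)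
  then show ?thesis unfolding has_derivative_real_iff_quotient
    using v0 by (simp add: bounded_linear_zero)
qed

lemma has_derivative_squeeze_zero:
  fixes e b :: "'a::real_normed_vector \<Rightarrow> real"
  assumes b: "(b has_derivative (\<lambda>h. 0)) (at y)" and b0: "b y = 0"
    and le: "\<forall>\<^sub>F x in nhds y. \<bar>e x\<bar> \<le> b x"
  shows "(e has_derivative (\<lambda>h. 0)) (at y)"
proof -
  have e0: "e y = 0" using eventually_nhds_x_imp_x[OF le] b0 by simp
  have "((\<lambda>x. b x / norm (x - y)) \<longlongrightarrow> 0) (at y)"
    using b b0 unfolding has_derivative_real_iff_quotient by simp
  then have "((\<lambda>x. e x / norm (x - y)) \<longlongrightarrow> 0) (at y)"
  proof (rule tendsto_0_le[where K = 1])
    have "\<forall>\<^sub>F x in at y. \<bar>e x\<bar> \<le> b x" using le by (simp add: eventually_nhds_conv_at)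
    then show "\<forall>\<^sub>F x in at y. norm (e x / norm (x - y)) \<le> norm (b x / norm (x - y)) * 1"
    proof eventually_elim
      case (elim x)
      then show ?case by (simp add: divide_right_mono)
    qed
  qed
  then show ?thesis unfolding has_derivative_real_iff_quotient
    using e0 by (simp add: bounded_linear_zero)
qed

text \<open>The envelope theorem for a family \<open>F x t = (\<Sum>k\<in>K. u k x * \<phi> k t)\<close> in which parameter and
  variable are separated.  If the maximiser \<open>s\<close> for the parameter \<open>y\<close> is strict, compactness forces
  the maximisers \<open>\<tau> x\<close> to converge to \<open>s\<close> as \<open>x \<rightarrow> y\<close>.  The maximum \<open>M\<close> is then squeezed:
  comparing with \<open>s\<close> bounds it from below by \<open>F x s\<close>, and comparing \<open>F y (\<tau> x)\<close> with
  \<open>F y s\<close> bounds it from above, the gap between the bounds being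
  \<open>\<Sum>k\<in>K. (u k x - u k y) * (\<phi> k (\<tau> x) - \<phi> k s)\<close>, which is \<open>o(norm (x - y))\<close>.
  So \<open>M\<close> has the derivative of \<open>F\<close> in the parameter at fixed \<open>s\<close>.

  The hypothesis on \<open>M\<close> speaks of some value attained on \<open>J\<close> that dominates the value at \<open>s\<close>,
  instead of the maximum over \<open>J\<close>, so that the maximum may be taken over a set that moves with the
  parameter inside \<open>J\<close>.\<close>

lemma envelope_has_derivative:
  fixes K :: "'k set" and u :: "'k \<Rightarrow> 'a::real_normed_vector \<Rightarrow> real" and \<phi> :: "'k \<Rightarrow> 'b::metric_space \<Rightarrow> real"
    and M :: "'a \<Rightarrow> real"
  defines "F \<equiv> \<lambda>x t. \<Sum>k\<in>K. u k x * \<phi> k t"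
  assumes u: "\<And>k. k \<in> K \<Longrightarrow> (u k has_derivative u' k) (at y)"
    and cont: "\<And>k. k \<in> K \<Longrightarrow> continuous_on J (\<phi> k)"
    and J: "compact J" "s \<in> J"
    and strict: "\<And>t. t \<in> J \<Longrightarrow> t \<noteq> s \<Longrightarrow> F y t < F y s"
    and M: "\<forall>\<^sub>F x in nhds y. \<exists>t\<in>J. M x = F x t \<and> F x s \<le> M x"
  shows "(M has_derivative (\<lambda>h. \<Sum>k\<in>K. u' k h * \<phi> k s)) (at y)"
proof -
  define \<tau> where "\<tau> x = (SOME t. t \<in> J \<and> M x = F x t \<and> F x s \<le> M x)" for x
  have ev: "\<forall>\<^sub>F x in nhds y. \<tau> x \<in> J \<and> M x = F x (\<tau> x) \<and> F x s \<le> M x"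
    using M
  proof eventually_elim
    case (elim x)
    then show ?case unfolding \<tau>_def by (intro someI_ex[where P = "\<lambda>t. t \<in> J \<and> M x = F x t \<and> F x s \<le> M x"]) auto
  qed
  have \<tau>y: "\<tau> y = s" and My: "M y = F y s"
    using eventually_nhds_x_imp_x[OF ev] strict[of "\<tau> y"] by force+
  have leF: "F y t \<le> F y s" if "t \<in> J" for t using strict[OF that] by (cases "t = s") auto
  have bdd: "\<exists>B\<ge>0. \<forall>t\<in>J. \<bar>\<phi> k t\<bar> \<le> B" if "k \<in> K" for k
  proof -
    have "bounded (\<phi> k ` J)" using cont[OF that] J(1) compact_continuous_image compact_imp_bounded by blast
    then show ?thesis using J(2) unfolding bounded_iff by (auto intro: order_trans[OF abs_ge_zero])
  qed
  then obtain B where B: "\<And>k. k \<in> K \<Longrightarrow> 0 \<le> B k \<and> (\<forall>t\<in>J. \<bar>\<phi> k t\<bar> \<le> B k)" by metis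
  have ulim: "(u k \<longlongrightarrow> u k y) (at y)" if "k \<in> K" for k
    using has_derivative_continuous[OF u[OF that]] by (simp add: continuous_within)
  \<comment> \<open>A bound, uniform over \<open>J\<close>, for the change of \<open>F\<close> when \<open>y\<close> is replaced by \<open>x\<close>.\<close>
  define E where "E x = (\<Sum>k\<in>K. \<bar>u k x - u k y\<bar> * B k)" for x
  have "(E \<longlongrightarrow> (\<Sum>k\<in>K. \<bar>u k y - u k y\<bar> * B k)) (at y)"
    unfolding E_def by (intro tendsto_intros ulim)
  then have E0: "(E \<longlongrightarrow> 0) (at y)" by simp
  have EF: "\<bar>F x t - F y t\<bar> \<le> E x" if "t \<in> J" for x t
  proof -
    have "F x t - F y t = (\<Sum>k\<in>K. (u k x - u k y) * \<phi> k t)"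
      unfolding F_def by (simp add: sum_subtractf sum.distrib algebra_simps)
    also have "\<bar>\<dots>\<bar> \<le> (\<Sum>k\<in>K. \<bar>(u k x - u k y) * \<phi> k t\<bar>)" by (rule sum_abs)
    also have "\<dots> \<le> E x" unfolding E_def
      using B that by (intro sum_mono) (auto simp: abs_mult intro!: mult_left_mono)
    finally show ?thesis .
  qed
  have \<tau>J: "\<forall>\<^sub>F x in at y. \<tau> x \<in> J"
    using ev by (auto simp: eventually_nhds_conv_at elim: eventually_mono)
  have \<tau>lim: "(\<tau> \<longlongrightarrow> s) (at y)"
  proof (rule tendstoI)
    fix e :: real assume e: "0 < e"
    \<comment> \<open>Away from \<open>s\<close> the values of \<open>F y\<close> stay below \<open>F y s\<close> by a fixed amount, which \<open>E\<close> cannot bridge near \<open>y\<close>.\<close>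
    define J' where "J' = J \<inter> - ball s e"
    have cJ': "compact J'" unfolding J'_def using J(1) by (intro compact_Int_closed) auto
    have contF: "continuous_on J (F y)" unfolding F_def by (intro continuous_intros cont)
    show "\<forall>\<^sub>F x in at y. dist (\<tau> x) s < e"
    proof (cases "J' = {}")
      case True
      from \<tau>J show ?thesis
      proof eventually_elim
        case (elim x)
        then show ?case using True unfolding J'_def by (auto simp: dist_commute)
      qed
    next
      case False
      obtain m where m: "m \<in> J'" "\<And>t. t \<in> J' \<Longrightarrow> F y t \<le> F y m"
        using continuous_attains_sup[OF cJ' False, of "F y"] continuous_on_subset[OF contF]
        unfolding J'_def by blast
      have gap: "F y m < F y s" using m(1) strict[of m] e unfolding J'_def by (cases "m = s") auto
      have "\<forall>\<^sub>F x in at y. E x < (F y s - F y m) / 2"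
        using order_tendstoD(2)[OF E0, of "(F y s - F y m) / 2"] gap by simp
      moreover have "\<forall>\<^sub>F x in at y. \<tau> x \<in> J \<and> M x = F x (\<tau> x) \<and> F x s \<le> M x"
        using ev by (auto simp: eventually_nhds_conv_at)
      ultimately show ?thesis
      proof eventually_elim
        case (elim x)
        have "F y (\<tau> x) > F y m" using EF[of "\<tau> x" x] EF[of s x] elim J(2) by (auto simp: field_simps)
        then have "\<tau> x \<notin> J'" using m(2) by force
        then show ?case using elim unfolding J'_def by (auto simp: dist_commute)
      qed
    qed
  qed
  have \<phi>lim: "((\<lambda>x. \<phi> k (\<tau> x)) \<longlongrightarrow> \<phi> k s) (at y)" if "k \<in> K" for k
    using continuous_on_tendsto_compose[OF cont[OF that] \<tau>lim J(2) \<tau>J] .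
  define b where "b x = (\<Sum>k\<in>K. (u k x - u k y) * (\<phi> k (\<tau> x) - \<phi> k s))" for x
  have "(b has_derivative (\<lambda>h. \<Sum>k\<in>K. 0)) (at y)" unfolding b_def
    using \<tau>y LIM_zero[OF \<phi>lim]
    by (intro has_derivative_sum has_derivative_mult_tendsto_zero[OF u]) auto
  then have b: "(b has_derivative (\<lambda>h. 0)) (at y)" by simp
  define e where "e x = M x - M y - (\<Sum>k\<in>K. (u k x - u k y) * \<phi> k s)" for x
  have "(e has_derivative (\<lambda>h. 0)) (at y)"
  proof (rule has_derivative_squeeze_zero[OF b])
    show "b y = 0" by (simp add: b_def)
    show "\<forall>\<^sub>F x in nhds y. \<bar>e x\<bar> \<le> b x" using ev
    proof eventually_elim
      case (elim x)
      have e1: "e x = M x - F x s"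
        unfolding e_def My F_def by (simp add: sum_subtractf sum.distrib algebra_simps)
      have "b x - e x = F y s - F y (\<tau> x)"
        using elim unfolding e_def b_def My F_def by (simp add: sum_subtractf sum.distrib algebra_simps)
      then show ?case using e1 elim leF[of "\<tau> x"] by auto
    qed
  qed
  moreover have "((\<lambda>x. M y + (\<Sum>k\<in>K. (u k x - u k y) * \<phi> k s)) has_derivative
      (\<lambda>h. 0 + (\<Sum>k\<in>K. (u' k h - 0) * \<phi> k s))) (at y)"
    by (intro derivative_intros u)
  ultimately have "((\<lambda>x. e x + (M y + (\<Sum>k\<in>K. (u k x - u k y) * \<phi> k s))) has_derivative
      (\<lambda>h. 0 + (0 + (\<Sum>k\<in>K. (u' k h - 0) * \<phi> k s)))) (at y)"
    by (rule has_derivative_add)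
  then show ?thesis by (simp add: e_def)
qed

section \<open>The largest root of the transcendental equation\<close>

text \<open>The number \<open>5/4\<close> is the square of the positive critical point of \<open>exp (- t\<^sup>2) * (4 * t\<^sup>2 - 1)\<close>.
  The estimate says that \<open>exp u - (4 * u - 1)\<close> is negative there, so that the largest root of this
  function lies to the right of it.\<close>

lemma exp_five_quarters_less: "exp (5/4::real) < 4"
proof -
  have "exp (1/4::real) \<le> 1 + 1/4 + (1/4)\<^sup>2" by (rule exp_bound) auto
  then have "exp (1/4::real) ^ 5 \<le> (21/16) ^ 5" by (intro power_mono) (auto simp: power2_eq_square)
  also have "exp (1/4::real) ^ 5 = exp (5/4)" by (simp add: exp_of_nat_mult[symmetric])
  finally show ?thesis by (simp add: eval_nat_numeral)
qed

text \<open>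
  \<open>GREATEST\<close> is specified only when a greatest element exists.  The roots of
  \<open>exp u = 4 * u - 1\<close> in \<open>{5/4..7}\<close> form a nonempty compact set, and beyond \<open>7\<close> the
  quadratic Taylor bound of the exponential excludes roots.
\<close>

lemma
  fixes C :: real
  defines "C \<equiv> (GREATEST u::real. exp (- u) * (4 * u - 1) = 1)"
  shows greatest_root_eq: "exp C = 4 * C - 1" and greatest_root_gt: "5/4 < C"
proof -
  define P where "P u \<longleftrightarrow> exp (- u) * (4 * u - 1) = 1" for u :: real
  have P_iff: "P u \<longleftrightarrow> exp u = 4 * u - 1" for u
    by (auto simp: P_def exp_minus field_simps)
  have big: "u < 7" if "P u" for u
  proof (rule ccontr)
    assume "\<not> u < 7"
    then have "exp u \<ge> 1 + u + u\<^sup>2 / 2" "u * 7 \<le> u * u"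
      using exp_lower_Taylor_quadratic[of u] by auto
    moreover have "exp u = 4 * u - 1" using that P_iff by blast
    ultimately show False using \<open>\<not> u < 7\<close> unfolding power2_eq_square by linarith
  qed
  define S where "S = {u \<in> {5/4..7::real}. exp u = 4 * u - 1}"
  have "closed {u::real. exp u = 4 * u - 1}" by (intro closed_Collect_eq continuous_intros)
  moreover have "S = {5/4..7} \<inter> {u. exp u = 4 * u - 1}" by (auto simp: S_def)
  ultimately have "compact S" by (metis compact_Icc compact_Int_closed)
  have ex: "\<exists>u. 5/4 \<le> u \<and> u \<le> 7 \<and> exp u - (4 * u - 1) = (0::real)"
    using exp_five_quarters_less exp_lower_Taylor_quadratic[of "7::real"]
    by (intro IVT' continuous_intros) auto
  then have "S \<noteq> {}" by (auto simp: S_def)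
  then obtain m where m: "m \<in> S" "\<And>u. u \<in> S \<Longrightarrow> u \<le> m"
    using compact_attains_sup[OF \<open>compact S\<close>] by blast
  have "C = m" unfolding C_def
  proof (rule Greatest_equality)
    show "exp (- m) * (4 * m - 1) = 1" using m(1) P_iff[of m] by (simp add: S_def P_def)
    fix u :: real assume "exp (- u) * (4 * u - 1) = 1"
    then have "P u" by (simp add: P_def)
    then show "u \<le> m" using big[of u] m(2)[of u] m(1) P_iff[of u]
      by (cases "u < 5/4") (auto simp: S_def)
  qed
  then show eq: "exp C = 4 * C - 1" using m(1) by (simp add: S_def)
  have "C \<noteq> 5/4"
  proof
    assume "C = 5/4"
    then show False using eq exp_five_quarters_less by (simp only:)
  qed
  then show "5/4 < C" using m(1) \<open>C = m\<close> by (simp add: S_def)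
qed

section \<open>The Lebesgue function as a Gaussian times a quadratic\<close>

lemma UNIV_3_minus:
  "UNIV - {1::3} = {2, 3}" "UNIV - {2::3} = {1, 3}" "UNIV - {3::3} = {1, 2}"
  using exhaust_3 by auto

definition node_weight :: "real^3 \<Rightarrow> 3 \<Rightarrow> real" where
  "node_weight x k = exp ((x $ k)\<^sup>2) / (\<Prod>l\<in>UNIV - {k}. x $ k - x $ l)"

text \<open>On each of the four intervals every fundamental function has a constant sign, so the Lebesgue
  function is the Gaussian times this quadratic polynomial, for the appropriate signs \<open>\<sigma>\<close>.
  For fixed \<open>\<sigma>\<close> its coefficients are differentiable functions of distinct nodes, so
  dependence on the nodes and dependence on \<open>t\<close> are separated.\<close>

definition signed_poly :: "(3 \<Rightarrow> real) \<Rightarrow> real^3 \<Rightarrow> real poly" where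
  "signed_poly \<sigma> x = (\<Sum>k\<in>UNIV. smult (\<sigma> k * node_weight x k) (\<Prod>l\<in>UNIV - {k}. [:- x $ l, 1:]))"

lemma fund_fun_eq:
  "fund_fun x k t = exp (- t\<^sup>2) * (node_weight x k * (\<Prod>l\<in>UNIV - {k}. t - x $ l))"
  by (simp add: fund_fun_def node_weight_def prod_dividef exp_minus field_simps)

lemma lebesgue_fun_eq:
  assumes "\<And>k. \<bar>fund_fun x k t\<bar> = \<sigma> k * fund_fun x k t"
  shows "lebesgue_fun x t = exp (- t\<^sup>2) * poly (signed_poly \<sigma> x) t"
  unfolding lebesgue_fun_def signed_poly_def assms
  by (simp add: fund_fun_eq poly_sum poly_prod sum_distrib_left mult_ac)

lemma signed_poly_eq:
  "signed_poly \<sigma> x =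
    (let w = (\<lambda>k. \<sigma> k * node_weight x k) in
    [:w 1 * (x $ 2 * x $ 3) + w 2 * (x $ 1 * x $ 3) + w 3 * (x $ 1 * x $ 2),
      - (w 1 * (x $ 2 + x $ 3) + w 2 * (x $ 1 + x $ 3) + w 3 * (x $ 1 + x $ 2)),
      w 1 + w 2 + w 3:])"
  by (simp add: signed_poly_def sum_3 UNIV_3_minus Let_def algebra_simps)

lemma node_weight_simps:
  "node_weight x 1 = exp ((x $ 1)\<^sup>2) / ((x $ 1 - x $ 2) * (x $ 1 - x $ 3))"
  "node_weight x 2 = exp ((x $ 2)\<^sup>2) / ((x $ 2 - x $ 1) * (x $ 2 - x $ 3))"
  "node_weight x 3 = exp ((x $ 3)\<^sup>2) / ((x $ 3 - x $ 1) * (x $ 3 - x $ 2))"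
  by (simp_all add: node_weight_def UNIV_3_minus)

lemma vec_nth_differentiable: "(\<lambda>x::real^3. x $ i) differentiable F"
  by (rule bounded_linear_imp_differentiable[OF bounded_linear_vec_nth])

lemma differentiable_exp:
  fixes f :: "'a::real_normed_vector \<Rightarrow> real"
  shows "f differentiable (at x) \<Longrightarrow> (\<lambda>x. exp (f x)) differentiable (at x)"
  unfolding differentiable_def by (blast intro: has_derivative_exp)

lemma node_weight_differentiable:
  fixes x :: "real^3"
  assumes "inj (($) x)"
  shows "(\<lambda>x. node_weight x k) differentiable (at x)"
proof -
  have "x $ k - x $ l \<noteq> 0" if "l \<noteq> k" for k l using assms that by (auto simp: inj_def)
  then show ?thesis
    using exhaust_3[of k]
    by (elim disjE; simp only: node_weight_simps)
      (intro derivative_intros vec_nth_differentiable differentiable_exp, simp)+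
qed

lemma coeff_signed_poly_differentiable:
  fixes x :: "real^3"
  assumes "inj (($) x)"
  shows "(\<lambda>x. coeff (signed_poly \<sigma> x) n) differentiable (at x)"
proof -
  note [derivative_intros] = vec_nth_differentiable node_weight_differentiable[OF assms]
  consider "n = 0" | "n = 1" | "n = 2" | m where "n = Suc (Suc (Suc m))"
    by (metis One_nat_def Suc_1 not0_implies_Suc)
  then show ?thesis unfolding signed_poly_eq Let_def
    by cases (simp_all add: numeral_2_eq_2, (intro derivative_intros)+)
qed

lemma lebesgue_fun_at_node:
  assumes "inj (($) x)"
  shows "lebesgue_fun x (x $ k) = 1"
proof -
  have nz: "x $ k - x $ l \<noteq> 0" if "l \<noteq> k" for k l using assms that by (auto simp: inj_def)
  have "\<bar>fund_fun x j (x $ k)\<bar> = (if j = k then 1 else 0)" for j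
  proof (cases "j = k")
    case True
    have "(\<Prod>l\<in>UNIV - {k}. (x $ k - x $ l) / (x $ k - x $ l)) = 1"
      using nz by (intro prod.neutral) auto
    then show ?thesis using True by (simp add: fund_fun_def)
  next
    case False
    then have "(\<Prod>l\<in>UNIV - {j}. (x $ k - x $ l) / (x $ j - x $ l)) = 0"
      by (intro prod_zero) auto
    then show ?thesis using False by (simp add: fund_fun_def)
  qed
  then show ?thesis by (simp add: lebesgue_fun_def)
qed

text \<open>The signs of the fundamental functions to the right of the last node, and between the last two
  nodes.  The other two intervals are handled by reflection at the origin.\<close>

abbreviation outer_sign :: "3 \<Rightarrow> real" where "outer_sign k \<equiv> if k = 2 then - 1 else 1"
abbreviation inner_sign :: "3 \<Rightarrow> real" where "inner_sign k \<equiv> if k = 1 then - 1 else 1"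

lemma node_weight_sign:
  assumes "x $ 1 < x $ 2" "x $ 2 < x $ 3"
  shows "node_weight x 1 > 0" "node_weight x 2 < 0" "node_weight x 3 > 0"
  using assms by (simp_all add: node_weight_simps divide_pos_neg mult_pos_neg mult_neg_neg)

lemma lebesgue_fun_outer:
  assumes "x $ 1 < x $ 2" "x $ 2 < x $ 3" "x $ 3 \<le> t"
  shows "lebesgue_fun x t = exp (- t\<^sup>2) * poly (signed_poly outer_sign x) t"
proof (rule lebesgue_fun_eq)
  fix k :: 3
  note w = node_weight_sign[OF assms(1,2)]
  show "\<bar>fund_fun x k t\<bar> = outer_sign k * fund_fun x k t"
    using exhaust_3[of k] assms w
    by (elim disjE; simp add: fund_fun_eq UNIV_3_minus abs_mult)
qed

lemma lebesgue_fun_inner: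
  assumes "x $ 1 < x $ 2" "x $ 2 < x $ 3" "x $ 2 \<le> t" "t \<le> x $ 3"
  shows "lebesgue_fun x t = exp (- t\<^sup>2) * poly (signed_poly inner_sign x) t"
proof (rule lebesgue_fun_eq)
  fix k :: 3
  note w = node_weight_sign[OF assms(1,2)]
  show "\<bar>fund_fun x k t\<bar> = inner_sign k * fund_fun x k t"
    using exhaust_3[of k] assms w
    by (elim disjE; simp add: fund_fun_eq UNIV_3_minus abs_mult; simp add: algebra_simps)
qed

lemma node_interval_simps:
  "node_interval 1 x = {..x $ 1}" "node_interval 2 x = {x $ 1..x $ 2}"
  "node_interval 3 x = {x $ 2..x $ 3}" "node_interval 4 x = {x $ 3..}"
  by (simp_all add: node_interval_def)

lemma interval_max_eqI:
  assumes "t \<in> node_interval i x" "\<And>s. s \<in> node_interval i x \<Longrightarrow> lebesgue_fun x s \<le> lebesgue_fun x t"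
  shows "interval_max i x = lebesgue_fun x t"
  unfolding interval_max_def using assms by (intro Greatest_equality) auto

text \<open>The defining description is unique because the interval is infinite: two polynomials that agree
  on an infinite set are equal.\<close>

lemma interval_fun_eqI:
  assumes "degree p \<le> 2" "\<And>t. t \<in> node_interval i x \<Longrightarrow> lebesgue_fun x t = exp (- t\<^sup>2) * poly p t"
    "infinite (node_interval i x)"
  shows "interval_fun i x = (\<lambda>t. exp (- t\<^sup>2) * poly p t)"
  unfolding interval_fun_def
proof (rule the_equality)
  show "\<exists>q. degree q \<le> 2 \<and> (\<lambda>t. exp (- t\<^sup>2) * poly p t) = (\<lambda>t. exp (- t\<^sup>2) * poly q t) \<and>
      (\<forall>t\<in>node_interval i x. exp (- t\<^sup>2) * poly p t = lebesgue_fun x t)"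
    using assms by auto
next
  fix f
  assume "\<exists>q. degree q \<le> 2 \<and> f = (\<lambda>t. exp (- t\<^sup>2) * poly q t) \<and>
      (\<forall>t\<in>node_interval i x. f t = lebesgue_fun x t)"
  then obtain q where q: "f = (\<lambda>t. exp (- t\<^sup>2) * poly q t)"
    "\<forall>t\<in>node_interval i x. f t = lebesgue_fun x t" by blast
  have "node_interval i x \<subseteq> {t. poly (p - q) t = 0}" using q assms(2) by auto
  then have "p - q = 0" using assms(3) poly_roots_finite finite_subset by blast
  then show "f = (\<lambda>t. exp (- t\<^sup>2) * poly p t)" using q by simp
qed

section \<open>Reflection at the origin\<close>

definition reflect :: "real^3 \<Rightarrow> real^3" where
  "reflect x = vector [- x $ 3, - x $ 2, - x $ 1]"

lemma reflect_nth [simp]: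
  "reflect x $ 1 = - x $ 3" "reflect x $ 2 = - x $ 2" "reflect x $ 3 = - x $ 1"
  by (simp_all add: reflect_def)

lemma bounded_linear_reflect: "bounded_linear reflect"
  by (auto intro!: linear_conv_bounded_linear[THEN iffD1] linearI simp: vec_eq_iff forall_3)

lemma lebesgue_fun_reflect: "lebesgue_fun (reflect x) t = lebesgue_fun x (- t)"
proof -
  have q: "(t + a) / (b - a) = (- t - a) / (a - b)" for a b :: real
    using minus_divide_divide[of "t + a" "b - a"] by simp
  show ?thesis
    by (simp add: lebesgue_fun_def fund_fun_def sum_3 UNIV_3_minus q[symmetric] algebra_simps)
qed

lemma node_interval_reflect:
  "node_interval 4 (reflect x) = uminus ` node_interval 1 x"
  "node_interval 3 (reflect x) = uminus ` node_interval 2 x"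
  by (simp_all add: node_interval_simps)

lemma interval_max_reflect:
  "interval_max 4 (reflect x) = interval_max 1 x"
  "interval_max 3 (reflect x) = interval_max 2 x"
  by (simp_all add: interval_max_def node_interval_reflect image_image lebesgue_fun_reflect)

section \<open>Gaussians times quadratics on a half-line\<close>

lemma has_derivative_gauss_quadratic:
  "((\<lambda>t. exp (- t\<^sup>2) * poly [:c0, c1, c2:] t) has_real_derivative
    exp (- t\<^sup>2) * (c1 + (2 * c2 - 2 * c0) * t - 2 * c1 * t\<^sup>2 - 2 * c2 * t ^ 3)) (at t)"
  by (auto intro!: derivative_eq_intros simp: algebra_simps power2_eq_square power3_eq_cube)

text \<open>The derivative is the Gaussian times a cubic with leading coefficient \<open>- 2 * c2\<close>.  Dividing the
  cubic by \<open>t ^ 3\<close> leaves a function of \<open>1 / t\<close>, whose lower-order terms are largest in absolute value at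
  \<open>t = r\<close>.  Hence a single strict inequality at \<open>r\<close>, continuous in the coefficients, controls the
  whole unbounded interval, and it survives small perturbations of the coefficients.\<close>

lemma gauss_quadratic_decreasing:
  fixes r :: real
  assumes r: "0 < r" "\<bar>c1\<bar> / r ^ 3 + \<bar>2 * c2 - 2 * c0\<bar> / r\<^sup>2 + 2 * \<bar>c1\<bar> / r - 2 * c2 < 0"
    and st: "r \<le> s" "s < t"
  shows "exp (- t\<^sup>2) * poly [:c0, c1, c2:] t < exp (- s\<^sup>2) * poly [:c0, c1, c2:] s"
proof (rule DERIV_neg_imp_decreasing[OF st(2)], intro exI conjI)
  fix y assume "s \<le> y"
  then have y: "r \<le> y" "0 < y" using r st by auto
  have "c1 / y ^ 3 \<le> \<bar>c1\<bar> / r ^ 3" using y r by (intro frac_le power_mono) auto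
  moreover have "(2 * c2 - 2 * c0) / y\<^sup>2 \<le> \<bar>2 * c2 - 2 * c0\<bar> / r\<^sup>2"
    using y r by (intro frac_le power_mono) auto
  moreover have "2 * (- c1) / y \<le> 2 * \<bar>c1\<bar> / r" using y r by (intro frac_le) auto
  ultimately have "c1 / y ^ 3 + (2 * c2 - 2 * c0) / y\<^sup>2 + 2 * (- c1) / y - 2 * c2 < 0"
    using r by linarith
  then have "y ^ 3 * (c1 / y ^ 3 + (2 * c2 - 2 * c0) / y\<^sup>2 + 2 * (- c1) / y - 2 * c2) < 0"
    using y by (simp add: mult_pos_neg)
  also have "y ^ 3 * (c1 / y ^ 3 + (2 * c2 - 2 * c0) / y\<^sup>2 + 2 * (- c1) / y - 2 * c2)
      = c1 + (2 * c2 - 2 * c0) * y - 2 * c1 * y\<^sup>2 - 2 * c2 * y ^ 3"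
    using y by (simp add: field_simps power2_eq_square power3_eq_cube)
  finally show "exp (- y\<^sup>2) * (c1 + (2 * c2 - 2 * c0) * y - 2 * c1 * y\<^sup>2 - 2 * c2 * y ^ 3) < 0"
    by (simp add: mult_pos_neg)
qed (rule has_derivative_gauss_quadratic)

section \<open>Derivatives along lines and the derivative matrix\<close>

lemma has_derivative_eventually_const:
  assumes "\<forall>\<^sub>F x in nhds y. f x = k"
  shows "(f has_derivative (\<lambda>h. 0)) (at y)"
proof -
  have "f y = k" using eventually_nhds_x_imp_x[OF assms] .
  then show ?thesis
    using assms
    by (intro has_derivative_transform_eventually[OF has_derivative_const[of k]])
      (auto simp: eventually_nhds_conv_at elim: eventually_mono)
qed

lemma has_field_derivative_along:
  assumes "(f has_derivative f') (at x)"
  shows "((\<lambda>s. f (x + s *\<^sub>R v)) has_real_derivative f' v) (at 0)"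
proof -
  have "((\<lambda>s::real. x + s *\<^sub>R v) has_derivative (\<lambda>s. s *\<^sub>R v)) (at 0)"
    by (auto intro!: derivative_eq_intros)
  from has_derivative_compose[OF this] assms
  have "((\<lambda>s. f (x + s *\<^sub>R v)) has_derivative (\<lambda>s. f' (s *\<^sub>R v))) (at 0)" by simp
  moreover have "f' (s *\<^sub>R v) = f' v * s" for s
    using linear_simps(5)[OF has_derivative_bounded_linear[OF assms]] by simp
  ultimately show ?thesis by (simp add: has_field_derivative_def)
qed

lemma not_invertible_zero_row:
  fixes A :: "real^3^3"
  assumes "A $ i = 0"
  shows "\<not> invertible A"
  using assms det_zero_row(1)[of i A] by (simp add: invertible_det_nz row_def vec_eq_iff)

lemma delete_row_not_invertible:
  assumes "A $ 1 = 0" "A $ 4 = 0"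
  shows "\<not> invertible (delete_row k A)"
proof (cases "k = 1")
  case True
  have "delete_row k A $ 3 = 0" using True assms by (simp add: delete_row_def)
  then show ?thesis by (rule not_invertible_zero_row)
next
  case False
  have "delete_row k A $ 1 = 0" using False assms exhaust_4[of k]
    by (auto simp add: delete_row_def)
  then show ?thesis by (rule not_invertible_zero_row)
qed

section \<open>The critical nodes\<close>

locale critical_nodes =
  fixes C c :: real
  assumes exp_C: "exp C = 4 * C - 1" and C_gt: "5/4 < C" and c_def: "c = sqrt C"
begin

definition xs :: "real^3" where "xs = vector [- c, 0, c]"

lemma xs_nth [simp]: "xs $ 1 = - c" "xs $ 2 = 0" "xs $ 3 = c"
  by (simp_all add: xs_def)

lemma c_sq: "c\<^sup>2 = C" and c_pos: "0 < c"
  using C_gt by (simp_all add: c_def)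

lemma C_eq: "C = c * c" using c_sq by (simp add: power2_eq_square)

lemma reflect_xs: "reflect xs = xs"
  by (simp add: vec_eq_iff forall_3)

lemma inj_xs: "inj (($) xs)"
  using c_pos by (auto simp: inj_def forall_3)

lemma node_weight_xs:
  "node_weight xs 1 = (4 * C - 1) / (2 * C)" "node_weight xs 2 = - 1 / C"
  "node_weight xs 3 = (4 * C - 1) / (2 * C)"
  using c_pos by (simp_all add: node_weight_simps c_sq exp_C) (simp_all add: C_eq)

text \<open>The quadratic coefficient is \<open>(exp C + 1) / C\<close>, and the equation for \<open>C\<close> says that it equals 4.\<close>

lemma signed_poly_outer_xs: "signed_poly outer_sign xs = [:- 1, 0, 4:]"
  using c_pos by (simp add: signed_poly_eq node_weight_xs Let_def) (simp add: C_eq field_simps)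

lemma signed_poly_inner_xs: "signed_poly inner_sign xs = [:1, (4 * C - 1) / c, - 1 / C:]"
  using c_pos by (simp add: signed_poly_eq node_weight_xs Let_def) (simp add: C_eq field_simps)

lemma coeff_tendsto: "((\<lambda>x. coeff (signed_poly \<sigma> x) n) \<longlongrightarrow> coeff (signed_poly \<sigma> xs) n) (nhds xs)"
  using differentiable_imp_continuous_within[OF coeff_signed_poly_differentiable[OF inj_xs]]
  by (subst tendsto_at_iff_tendsto_nhds[symmetric]) (simp add: continuous_within)

lemma nth_tendsto: "((\<lambda>x. x $ i) \<longlongrightarrow> xs $ i) (nhds xs)"
  by (intro tendsto_vec_nth filterlim_ident)

lemma eventually_ordered: "\<forall>\<^sub>F x in nhds xs. x $ 1 < x $ 2 \<and> x $ 2 < x $ 3"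
proof -
  have l: "- (c / 2) < xs $ 2" "xs $ 2 < c / 2" "xs $ 1 < - (c / 2)" "c / 2 < xs $ 3" using c_pos by auto
  show ?thesis
    using order_tendstoD(1)[OF nth_tendsto l(1)] order_tendstoD(2)[OF nth_tendsto l(2)]
      order_tendstoD(2)[OF nth_tendsto l(3)] order_tendstoD(1)[OF nth_tendsto l(4)]
    by eventually_elim auto
qed

lemma inj_ordered: "x $ 1 < x $ 2 \<Longrightarrow> x $ 2 < x $ 3 \<Longrightarrow> inj (($) x)" for x :: "real^3"
  by (auto simp: inj_def forall_3)

text \<open>At the critical nodes the cubic of the derivative is \<open>10 * t - 8 * t ^ 3\<close>, which is negative for
  \<open>t > sqrt (5/4)\<close>.  With a radius \<open>r\<close> strictly between \<open>sqrt (5/4)\<close> and \<open>c\<close> the criterion for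
  decrease on \<open>{r..}\<close> holds strictly at the critical nodes, hence also at all nearby nodes, for which
  moreover the last node exceeds \<open>r\<close>.\<close>

lemma outer_strict:
  "\<forall>\<^sub>F x in nhds xs. x $ 1 < x $ 2 \<and> x $ 2 < x $ 3 \<and>
     (\<forall>t>x $ 3. lebesgue_fun x t < lebesgue_fun x (x $ 3))"
proof -
  define r where "r = sqrt ((C + 5/4) / 2)"
  have r: "0 < r" "r\<^sup>2 > 5/4" "r < c" using C_gt by (auto simp: r_def c_def)
  define D where "D x = (let a = coeff (signed_poly outer_sign x) in
    \<bar>a 1\<bar> / r ^ 3 + \<bar>2 * a 2 - 2 * a 0\<bar> / r\<^sup>2 + 2 * \<bar>a 1\<bar> / r - 2 * a 2)" for x
  have "(D \<longlongrightarrow> D xs) (nhds xs)"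
    unfolding D_def Let_def using r by (intro tendsto_intros coeff_tendsto) auto
  moreover have "D xs < 0"
    using r by (simp add: D_def signed_poly_outer_xs numeral_2_eq_2 field_simps)
  ultimately have "\<forall>\<^sub>F x in nhds xs. D x < 0" by (rule order_tendstoD(2))
  moreover have "\<forall>\<^sub>F x in nhds xs. r < x $ 3"
    using order_tendstoD(1)[OF nth_tendsto[of 3]] r by simp
  ultimately show ?thesis using eventually_ordered
  proof eventually_elim
    case (elim x)
    define p where "p = signed_poly outer_sign x"
    obtain c0 c1 c2 where p: "p = [:c0, c1, c2:]"
      by (auto simp: p_def signed_poly_eq Let_def)
    have "lebesgue_fun x t < lebesgue_fun x (x $ 3)" if "x $ 3 < t" for t
      using gauss_quadratic_decreasing[of r c1 c2 c0 "x $ 3" t] elim r that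
      by (simp add: lebesgue_fun_outer D_def Let_def p_def[symmetric] p numeral_2_eq_2)
    then show ?case using elim by blast
  qed
qed

text \<open>The maximum is attained at the node, where the Lebesgue function is 1 whatever the nodes are.
  So \<open>interval_max 4\<close> is locally constant, and its gradient vanishes.\<close>

lemma eventually_interval_max_4: "\<forall>\<^sub>F x in nhds xs. interval_max 4 x = 1"
  using outer_strict
proof eventually_elim
  case (elim x)
  then have "interval_max 4 x = lebesgue_fun x (x $ 3)"
    by (intro interval_max_eqI) (auto simp: node_interval_simps le_less)
  then show ?case using elim by (simp add: lebesgue_fun_at_node inj_ordered)
qed

lemma reflect_tendsto: "filterlim reflect (nhds xs) (nhds xs)"
  using bounded_linear.tendsto[OF bounded_linear_reflect filterlim_ident, of xs] by (simp add: reflect_xs)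

lemma eventually_interval_max_1: "\<forall>\<^sub>F x in nhds xs. interval_max 1 x = 1"
  using eventually_compose_filterlim[OF eventually_interval_max_4 reflect_tendsto]
  by (simp add: interval_max_reflect)

text \<open>The derivative of \<open>F\<close> is the Gaussian times a cubic \<open>g\<close>.  On \<open>{0..c}\<close> the cubic decreases strictly,
  from a positive to a negative value, so \<open>F\<close> has exactly one maximiser there, and it lies inside.  The margin
  \<open>\<delta>\<close> makes room for the interval to move with its end nodes; it exists because the values at both ends lie
  strictly below the maximum.\<close>

lemma inner_max:
  defines "F \<equiv> \<lambda>t. exp (- t\<^sup>2) * poly [:1, (4 * C - 1) / c, - 1 / C:] t"
  shows "\<exists>s \<delta>. 0 < s \<and> s < c \<and> 0 < \<delta> \<and> (\<forall>t\<in>{- \<delta>..c + \<delta>}. t \<noteq> s \<longrightarrow> F t < F s)"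
proof -
  define a where "a = (4 * C - 1) / c"
  define g where "g t = a + (- 2 / C - 2) * t - 2 * a * t\<^sup>2 + 2 / C * t ^ 3" for t
  have F': "(F has_real_derivative exp (- t\<^sup>2) * g t) (at t)" for t
    unfolding F_def
    by (rule DERIV_cong[OF has_derivative_gauss_quadratic]) (simp add: g_def a_def)
  have contF: "continuous_on S F" for S
    using F' by (meson DERIV_isCont continuous_at_imp_continuous_on)
  have a_pos: "a > 0" using C_gt c_pos by (simp add: a_def)
  have g0: "g 0 > 0" using a_pos by (simp add: g_def)
  have gc: "g c < 0"
  proof -
    have "g c * c = (4 * C - 1) * (1 - 2 * C) - 2"
      using c_pos C_gt unfolding g_def a_def C_eq
      by (simp add: field_simps power2_eq_square power3_eq_cube)
    also have "\<dots> < 0" using mult_pos_neg[of "4 * C - 1" "1 - 2 * C"] C_gt by simp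
    finally show ?thesis using c_pos by (simp add: mult_less_0_iff)
  qed
  have g': "(g has_real_derivative (- 2 / C - 2) - 4 * a * t + 6 / C * t\<^sup>2) (at t)" for t
    using C_gt unfolding g_def by (auto intro!: derivative_eq_intros simp: power2_eq_square)
  have g'neg: "(- 2 / C - 2) - 4 * a * t + 6 / C * t\<^sup>2 < 0" if "0 \<le> t" "t \<le> c" for t
  proof -
    have "6 / C * t \<le> 4 * a"
    proof -
      have "6 / C * t \<le> 6 / C * c" using that C_gt by (intro mult_left_mono) auto
      also have "\<dots> = 6 / c" using c_pos by (simp add: C_eq)
      \<comment> \<open>\<open>C > 5/4\<close> gives \<open>4 * (4 * C - 1) \<ge> 16\<close>, which exceeds the required 6.\<close>
      also have "\<dots> \<le> 4 * a" using c_pos C_gt by (simp add: a_def divide_right_mono)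
      finally show ?thesis .
    qed
    from mult_right_mono[OF this that(1)] have "6 / C * t\<^sup>2 \<le> 4 * a * t"
      by (simp add: power2_eq_square mult_ac)
    moreover have "- 2 / C < 0" using C_gt by simp
    ultimately show ?thesis by linarith
  qed
  have gdec: "g v < g u" if "0 \<le> u" "u < v" "v \<le> c" for u v
    by (rule DERIV_neg_imp_decreasing[OF that(2)]) (use g' g'neg that in force)
  have "continuous_on {0..c} g"
    using g' by (meson DERIV_isCont continuous_at_imp_continuous_on)
  then obtain s where s: "0 \<le> s" "s \<le> c" "g s = 0"
    using IVT2'[of g c 0 0] g0 gc c_pos by auto
  then have s': "0 < s" "s < c" using g0 gc by (auto simp: le_less)
  have lt: "F t < F s" if "0 \<le> t" "t < s" for t
  proof (rule DERIV_pos_imp_increasing_open[OF that(2) _ contF])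
    fix y assume "t < y" "y < s"
    then show "\<exists>d. (F has_real_derivative d) (at y) \<and> d > 0"
      using F'[of y] gdec[of y s] s that by (intro exI[of _ "exp (- y\<^sup>2) * g y"]) auto
  qed
  have gt: "F t < F s" if "s < t" "t \<le> c" for t
  proof (rule DERIV_neg_imp_decreasing_open[OF that(1) _ contF])
    fix y assume "s < y" "y < t"
    then show "\<exists>d. (F has_real_derivative d) (at y) \<and> d < 0"
      using F'[of y] gdec[of s y] s that by (intro exI[of _ "exp (- y\<^sup>2) * g y"]) (auto simp: mult_pos_neg)
  qed
  have ev: "\<exists>d>0. \<forall>t. \<bar>t - u\<bar> < d \<longrightarrow> F t < F s" if "F u < F s" for u
  proof -
    have "\<forall>\<^sub>F t in nhds u. F t < F s"
      using order_tendstoD(2)[OF _ that] DERIV_isCont[OF F'[of u]]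
      by (simp add: isCont_def tendsto_at_iff_tendsto_nhds)
    then show ?thesis by (simp add: eventually_nhds_metric dist_real_def)
  qed
  obtain d1 where d1: "d1 > 0" "\<And>t. \<bar>t - 0\<bar> < d1 \<Longrightarrow> F t < F s" using ev[of 0] lt[of 0] s' by auto
  obtain d2 where d2: "d2 > 0" "\<And>t. \<bar>t - c\<bar> < d2 \<Longrightarrow> F t < F s" using ev[of c] gt[of c] s' by auto
  have "F t < F s" if "t \<in> {- (min d1 d2 / 2)..c + min d1 d2 / 2}" "t \<noteq> s" for t
  proof -
    consider "t < 0" | "0 \<le> t" "t < s" | "s < t" "t \<le> c" | "c < t" using \<open>t \<noteq> s\<close> by linarith
    then show ?thesis
      by cases (use that d1(1) d2(1) in \<open>auto intro: d1(2) d2(2) lt gt\<close>)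
  qed
  then show ?thesis using s' d1(1) d2(1)
    by (intro exI[of _ s] exI[of _ "min d1 d2 / 2"]) auto
qed

text \<open>The envelope theorem applies with \<open>\<phi> n t = exp (- t\<^sup>2) * t ^ n\<close> and with the coefficients of the
  polynomial as functions of the nodes; the set \<open>J\<close> is the interval between the last two critical
  nodes, enlarged so that it contains the corresponding interval of all nearby nodes.\<close>

lemma interval_max_3_differentiable: "interval_max 3 differentiable (at xs)"
proof -
  define F where "F x t = (\<Sum>n\<in>{..2}. coeff (signed_poly inner_sign x) n * (exp (- t\<^sup>2) * t ^ n))"
    for x :: "real^3" and t :: real
  have F_eq: "F x t = exp (- t\<^sup>2) * poly (signed_poly inner_sign x) t" for x t
    by (simp add: F_def signed_poly_eq Let_def numeral_2_eq_2 algebra_simps)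
  obtain s \<delta> where s: "0 < s" "s < c" "0 < \<delta>"
    and strict: "\<And>t. t \<in> {- \<delta>..c + \<delta>} \<Longrightarrow> t \<noteq> s \<Longrightarrow> F xs t < F xs s"
    using inner_max unfolding F_eq signed_poly_inner_xs by blast
  have "\<exists>u'. ((\<lambda>x. coeff (signed_poly inner_sign x) n) has_derivative u') (at xs)" for n
    using coeff_signed_poly_differentiable[OF inj_xs] by (simp add: differentiable_def)
  then obtain u' where u': "\<And>n. ((\<lambda>x. coeff (signed_poly inner_sign x) n) has_derivative u' n) (at xs)"
    by metis
  have "(interval_max 3 has_derivative (\<lambda>h. \<Sum>n\<in>{..2}. u' n h * (exp (- s\<^sup>2) * s ^ n))) (at xs)"
  proof (rule envelope_has_derivative[where J = "{- \<delta>..c + \<delta>}" and u = "\<lambda>n x. coeff (signed_poly inner_sign x) n"])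
    show "\<forall>\<^sub>F x in nhds xs. \<exists>t\<in>{- \<delta>..c + \<delta>}.
        interval_max 3 x = (\<Sum>n\<in>{..2}. coeff (signed_poly inner_sign x) n * (exp (- t\<^sup>2) * t ^ n)) \<and>
        (\<Sum>n\<in>{..2}. coeff (signed_poly inner_sign x) n * (exp (- s\<^sup>2) * s ^ n)) \<le> interval_max 3 x"
      unfolding F_def[symmetric]
    proof -
      have l: "- \<delta> < xs $ 2" "xs $ 2 < s" "s < xs $ 3" "xs $ 3 < c + \<delta>" using s by auto
      show "\<forall>\<^sub>F x in nhds xs. \<exists>t\<in>{- \<delta>..c + \<delta>}. interval_max 3 x = F x t \<and> F x s \<le> interval_max 3 x"
        using eventually_ordered order_tendstoD(1)[OF nth_tendsto l(1)] order_tendstoD(2)[OF nth_tendsto l(2)]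
          order_tendstoD(1)[OF nth_tendsto l(3)] order_tendstoD(2)[OF nth_tendsto l(4)]
      proof eventually_elim
        case (elim x)
        have L: "lebesgue_fun x t = F x t" if "t \<in> {x $ 2..x $ 3}" for t
          using lebesgue_fun_inner[of x t] elim that by (simp add: F_eq)
        have "continuous_on {x $ 2..x $ 3} (F x)" unfolding F_eq by (intro continuous_intros)
        then obtain t where t: "t \<in> {x $ 2..x $ 3}" "\<And>r. r \<in> {x $ 2..x $ 3} \<Longrightarrow> F x r \<le> F x t"
          using continuous_attains_sup[of "{x $ 2..x $ 3}" "F x"] elim by auto
        have "interval_max 3 x = F x t"
          using t L by (subst L[symmetric]; (intro interval_max_eqI)?) (auto simp: node_interval_simps)
        then show ?case using t(1) t(2)[of s] elim by (intro bexI[of _ t]) auto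
      qed
    qed
    show "\<And>t. t \<in> {- \<delta>..c + \<delta>} \<Longrightarrow> t \<noteq> s \<Longrightarrow>
      (\<Sum>n\<in>{..2}. coeff (signed_poly inner_sign xs) n * (exp (- t\<^sup>2) * t ^ n)) <
      (\<Sum>n\<in>{..2}. coeff (signed_poly inner_sign xs) n * (exp (- s\<^sup>2) * s ^ n))"
      using strict unfolding F_def .
  qed (use s u' in \<open>auto intro!: continuous_intros\<close>)
  then show ?thesis by (auto simp: differentiable_def)
qed

lemma interval_max_2_differentiable: "interval_max 2 differentiable (at xs)"
proof -
  have "(\<lambda>x. interval_max 3 (reflect x)) differentiable (at xs)"
    using interval_max_3_differentiable bounded_linear_imp_differentiable[OF bounded_linear_reflect]
    by (intro differentiable_compose[of "interval_max 3" reflect]) (auto simp: reflect_xs)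
  then show ?thesis by (simp add: interval_max_reflect)
qed

lemma interval_max_1_4_has_derivative:
  "(interval_max 1 has_derivative (\<lambda>h. 0)) (at xs)" "(interval_max 4 has_derivative (\<lambda>h. 0)) (at xs)"
  by (rule has_derivative_eventually_const, rule eventually_interval_max_1 eventually_interval_max_4)+

lemma interval_max_differentiable: "interval_max i differentiable (at xs)"
  using exhaust_4[of i] interval_max_2_differentiable interval_max_3_differentiable
    interval_max_1_4_has_derivative
  by (auto simp: differentiable_def)

lemma lebesgue_fun_xs_minus: "lebesgue_fun xs (- t) = lebesgue_fun xs t"
  using lebesgue_fun_reflect[of xs t] by (simp add: reflect_xs)

lemma lebesgue_fun_xs_outer: "c \<le> t \<Longrightarrow> lebesgue_fun xs t = exp (- t\<^sup>2) * (4 * t\<^sup>2 - 1)"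
  using lebesgue_fun_outer[of xs t] c_pos
  by (simp add: signed_poly_outer_xs power2_eq_square algebra_simps)

lemma interval_fun_xs:
  assumes "i = 1 \<or> i = 4"
  shows "interval_fun i xs = (\<lambda>t. exp (- t\<^sup>2) * (4 * t\<^sup>2 - 1))"
proof -
  have "interval_fun i xs = (\<lambda>t. exp (- t\<^sup>2) * poly [:- 1, 0, 4:] t)"
  proof (rule interval_fun_eqI)
    fix t assume "t \<in> node_interval i xs"
    then show "lebesgue_fun xs t = exp (- t\<^sup>2) * poly [:- 1, 0, 4:] t"
      using assms lebesgue_fun_xs_outer[of t] lebesgue_fun_xs_outer[of "- t"] lebesgue_fun_xs_minus[of t]
      by (auto simp: node_interval_simps power2_eq_square algebra_simps)
  qed (use assms in \<open>auto simp: node_interval_simps infinite_Ici infinite_Iic\<close>)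
  then show ?thesis by (simp add: power2_eq_square mult_ac)
qed

lemma deriv_interval_fun_xs:
  assumes "i = 1 \<or> i = 4"
  shows "deriv (interval_fun i xs) t = exp (- t\<^sup>2) * (2 * t * (5 - 4 * t\<^sup>2))"
  unfolding interval_fun_xs[OF assms]
  by (rule DERIV_imp_deriv)
    (auto intro!: derivative_eq_intros simp: power2_eq_square algebra_simps)

lemma lebesgue_fun_xs_less: "c < \<bar>t\<bar> \<Longrightarrow> lebesgue_fun xs t < 1"
  using eventually_nhds_x_imp_x[OF outer_strict] lebesgue_fun_at_node[OF inj_xs, of 3]
    lebesgue_fun_xs_minus[of t]
  by (cases "t \<ge> 0") auto

lemma lebesgue_fun_xs_end: "lebesgue_fun xs c = 1" "lebesgue_fun xs (- c) = 1"
  using lebesgue_fun_at_node[OF inj_xs, of 3] lebesgue_fun_at_node[OF inj_xs, of 1] by simp_all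

lemma is_arg_max_xs:
  "is_arg_max (lebesgue_fun xs) (\<lambda>t. t \<in> node_interval 1 xs) t \<longleftrightarrow> t = - c"
  "is_arg_max (lebesgue_fun xs) (\<lambda>t. t \<in> node_interval 4 xs) t \<longleftrightarrow> t = c"
proof -
  have le: "lebesgue_fun xs t \<le> 1" if "c \<le> \<bar>t\<bar>" for t
    using that lebesgue_fun_xs_less[of t] lebesgue_fun_xs_end by (cases "\<bar>t\<bar> = c") (auto simp: abs_if split: if_splits)
  show "is_arg_max (lebesgue_fun xs) (\<lambda>t. t \<in> node_interval 1 xs) t \<longleftrightarrow> t = - c"
  proof
    assume "is_arg_max (lebesgue_fun xs) (\<lambda>t. t \<in> node_interval 1 xs) t"
    then have "t \<le> - c" "\<not> lebesgue_fun xs t < lebesgue_fun xs (- c)"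
      by (auto simp: is_arg_max_def node_interval_simps)
    then show "t = - c" using lebesgue_fun_xs_less[of t] lebesgue_fun_xs_end c_pos by (cases "t = - c") auto
  qed (use le lebesgue_fun_xs_end c_pos in \<open>force simp: is_arg_max_def node_interval_simps not_less\<close>)
  show "is_arg_max (lebesgue_fun xs) (\<lambda>t. t \<in> node_interval 4 xs) t \<longleftrightarrow> t = c"
  proof
    assume "is_arg_max (lebesgue_fun xs) (\<lambda>t. t \<in> node_interval 4 xs) t"
    then have "c \<le> t" "\<not> lebesgue_fun xs t < lebesgue_fun xs c"
      by (auto simp: is_arg_max_def node_interval_simps)
    then show "t = c" using lebesgue_fun_xs_less[of t] lebesgue_fun_xs_end c_pos by (cases "t = c") auto
  qed (use le lebesgue_fun_xs_end c_pos in \<open>force simp: is_arg_max_def node_interval_simps not_less\<close>)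
qed

lemma deriv_matrix_xs: "deriv_matrix xs $ 1 = 0" "deriv_matrix xs $ 4 = 0"
  using DERIV_imp_deriv[OF has_field_derivative_along[OF interval_max_1_4_has_derivative(1)]]
    DERIV_imp_deriv[OF has_field_derivative_along[OF interval_max_1_4_has_derivative(2)]]
  by (simp_all add: deriv_matrix_def vec_eq_iff)

lemma field_differentiable_xs:
  "(\<lambda>s. interval_max i (xs + s *\<^sub>R v)) field_differentiable (at 0)"
  using interval_max_differentiable[of i] has_field_derivative_along
  by (fastforce simp: differentiable_def field_differentiable_def)

end

theorem mainTheorem4:
  fixes C c :: real and xs :: "real^3"
  assumes C: "C = (GREATEST u::real. exp (- u) * (4 * u - 1) = 1)"
    and c: "c = sqrt C"
    and xs: "xs = vector [- c, 0, c]"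
  shows "interval_fun 1 xs = (\<lambda>t. exp (- t\<^sup>2) * (4 * t\<^sup>2 - 1)) \<and>
         interval_fun 4 xs = (\<lambda>t. exp (- t\<^sup>2) * (4 * t\<^sup>2 - 1)) \<and>
         interval_max 1 xs = 1 \<and>
         (\<forall>t. is_arg_max (lebesgue_fun xs) (\<lambda>t. t \<in> node_interval 1 xs) t \<longleftrightarrow> t = - c) \<and>
         interval_max 4 xs = 1 \<and>
         (\<forall>t. is_arg_max (lebesgue_fun xs) (\<lambda>t. t \<in> node_interval 4 xs) t \<longleftrightarrow> t = c) \<and>
         deriv (interval_fun 1 xs) (- c) > 0 \<and>
         deriv (interval_fun 4 xs) c < 0 \<and>
         (GDERIV (interval_max 1) xs :> 0) \<and>
         (GDERIV (interval_max 4) xs :> 0) \<and>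
         (\<forall>i j. (\<lambda>s. interval_max i (xs + s *\<^sub>R axis j 1)) field_differentiable (at 0)) \<and>
         (\<forall>k. \<not> invertible (delete_row k (deriv_matrix xs)))"
proof -
  interpret R: critical_nodes C c
    using greatest_root_eq greatest_root_gt C c by unfold_locales auto
  have [simp]: "xs = R.xs" by (simp add: xs R.xs_def)
  have neg: "c * (5 - 4 * c\<^sup>2) < 0"
    using R.c_pos R.c_sq R.C_gt by (intro mult_pos_neg) auto
  then have "deriv (interval_fun 1 xs) (- c) > 0" "deriv (interval_fun 4 xs) c < 0"
    by (simp_all add: R.deriv_interval_fun_xs zero_less_mult_iff mult_less_0_iff)
  then show ?thesis
    using R.interval_fun_xs eventually_nhds_x_imp_x[OF R.eventually_interval_max_1]
      eventually_nhds_x_imp_x[OF R.eventually_interval_max_4] R.is_arg_max_xs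
      R.interval_max_1_4_has_derivative R.field_differentiable_xs
      delete_row_not_invertible[OF R.deriv_matrix_xs]
    by (simp add: gderiv_def)
qed

end
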